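(* Let $i\in\{0,1\}$ and $\epsilon>0$. Suppose class $1-i$ is the target class of a successful backdoor attack with backdoor pattern ${\bf v}_0\in\mathcal{X}$, i.e. for (almost) every sample ${\bf X}\sim P_i$ one has $f({\bf X})=i$ and $f({\bf X}+{\bf v}_0)\neq f({\bf X})$. If $\|{\bf v}_0\|_2\le\epsilon$, then for ${\bf X},{\bf Y}$ i.i.d. with distribution $P_i$, $$\mathrm{P}\big(\mathcal{V}_\epsilon({\bf X})\cap\mathcal{V}_\epsilon({\bf Y})\neq\emptyset\big)=1,$$ and furthermore $\mathrm{ET}_{i,\epsilon}=1$.
   Context: Setting: $\mathcal{X}=\mathbb{R}^n$ is the sample space, $\mathcal{C}=\{0,1\}$ the label space, $f:\mathcal{X}\to\mathcal{C}$ a classifier, and for each class $i\in\mathcal{C}$, $P_i$ is a continuous probability distribution on $\mathcal{X}$ (the sample distribution of class $i$). All events whose probabilities appear are assumed measurable. For ${\bf x}\in\mathcal{X}$, ${\bf v}^*({\bf x})$ denotes an optimal solution of: minimize $\|{\bf v}\|_2$ over ${\bf v}\in\mathcal{X}$ subject to $f({\bf x}+{\bf v})\neq f({\bf x})$ (such a solution is assumed to exist for $P_i$-almost every ${\bf x}$). $\epsilon$-solution set: for $\epsilon>0$, $$\mathcal{V}_\epsilon({\bf x})=\{{\bf v}\in\mathcal{X} : \|{\bf v}\|_2-\|{\bf v}^*({\bf x})\|_2\le\epsilon,\ f({\bf x}+{\bf v})\neq f({\bf x})\}.$$ Transferable set: $$\mathcal{T}_\epsilon({\bf x})=\{{\bf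 y}\in\mathcal{X} : f({\bf y})=f({\bf x}),\ \exists\,{\bf v}\in\mathcal{V}_\epsilon({\bf x})\text{ such that } f({\bf y}+{\bf v})\neq f({\bf y})\}.$$ ET (expected transferability) statistic: for ${\bf X},{\bf Y}$ i.i.d. with distribution $P_i$, $\mathrm{ET}_{i,\epsilon}=\mathbb{E}\big[\mathrm{P}({\bf Y}\in\mathcal{T}_\epsilon({\bf X})\mid{\bf X})\big]$. *)

theory Defs
  imports "HOL-Probability.Probability"
begin

text \<open>
  ``Continuous'' is read as ``without atoms''. This is the weakest usual reading: it is implied by
  having a density with respect to Lebesgue measure.
\<close>

definition continuous_distribution :: "(real ^ 'n) measure \<Rightarrow> bool" where
  "continuous_distribution D \<longleftrightarrow>
     prob_space D \<and> sets D = sets borel \<and> (\<forall>x. measure D {x} = 0)"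

text \<open>
  A map \<open>vstar\<close> selects an optimal solution of the minimization problem at each point where this
  predicate holds; elsewhere its value is unconstrained.
\<close>

definition optimal_perturbation :: "(real ^ 'n \<Rightarrow> nat) \<Rightarrow> real ^ 'n \<Rightarrow> real ^ 'n \<Rightarrow> bool" where
  "optimal_perturbation f x v \<longleftrightarrow> is_arg_min norm (\<lambda>w. f (x + w) \<noteq> f x) v"

definition eps_solution_set ::
    "(real ^ 'n \<Rightarrow> nat) \<Rightarrow> (real ^ 'n \<Rightarrow> real ^ 'n) \<Rightarrow> real \<Rightarrow> real ^ 'n \<Rightarrow> (real ^ 'n) set" where
  "eps_solution_set f vstar \<epsilon> x =
     {v. norm v - norm (vstar x) \<le> \<epsilon> \<and> f (x + v) \<noteq> f x}"

definition transferable_set ::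
    "(real ^ 'n \<Rightarrow> nat) \<Rightarrow> (real ^ 'n \<Rightarrow> real ^ 'n) \<Rightarrow> real \<Rightarrow> real ^ 'n \<Rightarrow> (real ^ 'n) set" where
  "transferable_set f vstar \<epsilon> x =
     {y. f y = f x \<and> (\<exists>v \<in> eps_solution_set f vstar \<epsilon> x. f (y + v) \<noteq> f y)}"

text \<open>
  The conditional probability of an event given \<open>X\<close> is the conditional expectation of its
  indicator with respect to the \<open>\<sigma>\<close>-algebra generated by \<open>X\<close>.
\<close>

definition cond_prob_given ::
    "'w measure \<Rightarrow> ('w \<Rightarrow> real ^ 'n) \<Rightarrow> 'w set \<Rightarrow> 'w \<Rightarrow> real" where
  "cond_prob_given M X A =
     real_cond_exp M (vimage_algebra (space M) X borel) (indicator A)"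

text \<open>
  The class enters \<open>ET\<close> only through the common distribution of the random variables \<open>X\<close> and \<open>Y\<close>
  on the probability space \<open>M\<close>.
\<close>

definition ET ::
    "'w measure \<Rightarrow> ('w \<Rightarrow> real ^ 'n) \<Rightarrow> ('w \<Rightarrow> real ^ 'n) \<Rightarrow>
     (real ^ 'n \<Rightarrow> nat) \<Rightarrow> (real ^ 'n \<Rightarrow> real ^ 'n) \<Rightarrow> real \<Rightarrow> real" where
  "ET M X Y f vstar \<epsilon> =
     (LINT \<omega>|M. cond_prob_given M X
        {\<omega>' \<in> space M. Y \<omega>' \<in> transferable_set f vstar \<epsilon> (X \<omega>')} \<omega>)"

definition iid_pair ::
    "'w measure \<Rightarrow> ('w \<Rightarrow> real ^ 'n) \<Rightarrow> ('w \<Rightarrow> real ^ 'n) \<Rightarrow> (real ^ 'n) measure \<Rightarrow> bool" where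
  "iid_pair M X Y D \<longleftrightarrow>
     prob_space M \<and> prob_space.indep_var M borel X borel Y \<and>
     distr M borel X = D \<and> distr M borel Y = D"

end

(* Since norm v0 <= eps <= eps + norm (vstar x), the pattern v0 itself lies in V_eps(x) for almost
   every x. It is thus a common element of V_eps(X) and V_eps(Y), and it witnesses Y \<in> T_eps(X). *)

theory Submission
  imports Defs
begin

lemma backdoor_in_eps_solution_set:
  assumes "norm v \<le> \<epsilon>" "f (x + v) \<noteq> f x"
  shows "v \<in> eps_solution_set f vstar \<epsilon> x"
  using assms by (simp add: eps_solution_set_def add_increasing2 diff_le_eq)

text \<open>Tower property: conditional expectation preserves the integral, and the indicator of
  \<open>A\<close> integrates to \<open>prob A\<close>. This turns \<open>ET\<close> into the
  probability of a single event on \<open>M\<close>.\<close>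

lemma (in prob_space) expectation_cond_prob_given:
  assumes X: "X \<in> borel_measurable M" and A: "A \<in> sets M"
  shows "(LINT \<omega>|M. cond_prob_given M X A \<omega>) = prob A"
proof -
  have sub: "subalgebra M (vimage_algebra (space M) X borel)"
    using X by (auto simp: subalgebra_def sets_vimage_algebra2 intro: measurable_sets)
  \<comment> \<open>Finiteness of \<open>M\<close> makes its restriction to the \<sigma>-algebra
    generated by \<open>X\<close> \<sigma>-finite, as the theory of \<open>real_cond_exp\<close>
    requires.\<close>
  interpret finite_measure_subalgebra M "vimage_algebra (space M) X borel"
    by unfold_locales (rule sub)
  have "integrable M (indicator A :: _ \<Rightarrow> real)"
    using A by (intro integrable_real_indicator) (auto simp: emeasure_eq_measure)
  from real_cond_exp_int(2)[OF this] show ?thesis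
    unfolding cond_prob_given_def using A by simp
qed

theorem theorem3p3:
  fixes f :: "real ^ 'n \<Rightarrow> nat"
    and P :: "nat \<Rightarrow> (real ^ 'n) measure"
    and vstar :: "real ^ 'n \<Rightarrow> real ^ 'n"
    and i :: nat and \<epsilon> :: real and v0 :: "real ^ 'n"
    and M :: "'w measure" and X Y :: "'w \<Rightarrow> real ^ 'n"
  assumes classifier: "\<And>x. f x \<in> {0, 1}"
    and distributions: "\<And>j. j \<in> {0, 1} \<Longrightarrow> continuous_distribution (P j)"
    and i: "i \<in> {0, 1}"
    and eps: "\<epsilon> > 0"
    and vstar: "AE x in P i. optimal_perturbation f x (vstar x)"
    and backdoor: "AE x in P i. f x = i \<and> f (x + v0) \<noteq> f x"
    and v0: "norm v0 \<le> \<epsilon>"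
    and iid: "iid_pair M X Y (P i)"
    and meas_inter: "{\<omega> \<in> space M. eps_solution_set f vstar \<epsilon> (X \<omega>) \<inter>
          eps_solution_set f vstar \<epsilon> (Y \<omega>) \<noteq> {}} \<in> sets M"
    and meas_transfer: "{\<omega> \<in> space M. Y \<omega> \<in> transferable_set f vstar \<epsilon> (X \<omega>)} \<in> sets M"
  shows "measure M {\<omega> \<in> space M. eps_solution_set f vstar \<epsilon> (X \<omega>) \<inter>
          eps_solution_set f vstar \<epsilon> (Y \<omega>) \<noteq> {}} = 1
       \<and> ET M X Y f vstar \<epsilon> = 1"
proof -
  interpret prob_space M
    using iid unfolding iid_pair_def by blast
  have X: "X \<in> borel_measurable M" and Y: "Y \<in> borel_measurable M"
    using iid indep_var_rv1 indep_var_rv2 unfolding iid_pair_def by blast+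
  have distr: "distr M borel X = P i" "distr M borel Y = P i"
    using iid unfolding iid_pair_def by blast+
  \<comment> \<open>Reading \<open>P i\<close> as the law of \<open>X\<close> pulls the null set of
    \<open>backdoor\<close> back to \<open>M\<close>. This direction needs measurability of
    \<open>X\<close> only, not of \<open>f\<close>.\<close>
  have "AE \<omega> in M. f (X \<omega>) = i \<and> f (X \<omega> + v0) \<noteq> f (X \<omega>)"
    using AE_distrD[OF X] backdoor unfolding distr(1)[symmetric] .
  moreover have "AE \<omega> in M. f (Y \<omega>) = i \<and> f (Y \<omega> + v0) \<noteq> f (Y \<omega>)"
    using AE_distrD[OF Y] backdoor unfolding distr(2)[symmetric] .
  \<comment> \<open>Outside the union of the two null sets both labels equal \<open>i\<close>, which
    gives the condition \<open>f y = f x\<close> in the transferable set.\<close>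
  ultimately have good: "AE \<omega> in M. v0 \<in> eps_solution_set f vstar \<epsilon> (X \<omega>) \<inter>
      eps_solution_set f vstar \<epsilon> (Y \<omega>) \<and> Y \<omega> \<in> transferable_set f vstar \<epsilon> (X \<omega>)"
    by eventually_elim
      (use backdoor_in_eps_solution_set[OF v0, of f _ vstar] in
        \<open>auto simp: transferable_set_def\<close>)
  have "prob {\<omega> \<in> space M. eps_solution_set f vstar \<epsilon> (X \<omega>) \<inter>
      eps_solution_set f vstar \<epsilon> (Y \<omega>) \<noteq> {}} = 1"
    \<comment> \<open>Measurability of the event is what lets probability one be replaced by an
      almost-sure statement.\<close>
    using good by (subst prob_Collect_eq_1[OF meas_inter]) (auto elim: eventually_mono)
  moreover have "prob {\<omega> \<in> space M. Y \<omega> \<in> transferable_set f vstar \<epsilon> (X \<omega>)} = 1"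
    using good by (subst prob_Collect_eq_1[OF meas_transfer]) (auto elim: eventually_mono)
  ultimately show ?thesis
    unfolding ET_def expectation_cond_prob_given[OF X meas_transfer] by blast
qed

end
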